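(* Let $\Bbbk$ be a field of characteristic zero and let $A$ be a noetherian Poisson stratiform domain over $\Bbbk$ such that $\mathbb D(1)=A$. Then $A$ is strongly Poisson skew cancellative in the category of noetherian Poisson stratiform domains.
   Context: A Poisson algebra is a commutative $\Bbbk$-algebra with a $\Bbbk$-bilinear bracket that is a Lie bracket and a biderivation; a Poisson domain is a Poisson algebra that is a domain. Divisor subalgebra. For a nonempty $F\subseteq A$ with $F\neq\{0\}$, let $\mathrm{Sw}(F)$ be the set of all $g\in A$ such that $f=gb$ for some $0\neq f\in F$ and some $b\in A$. Put $D_0(F)=F$ and, for $n\ge1$, let $D_n(F)$ be the Poisson $\Bbbk$-subalgebra of $A$ generated by $\mathrm{Sw}(D_{n-1}(F))$. Then $\mathbb D(F)=\bigcup_{n\ge0}D_n(F)$, and $\mathbb D(1)=\mathbb D(\{1\})$. Poisson-Ore extensions. A Poisson derivation of $A$ is a $\Bbbk$-linear derivation $\alpha$ with $\alpha(\{a,b\})=\{\alpha(a),b\}+\{a,\alpha(b)\}$. A Poisson $\alpha$-derivation is a $\Bbbk$-linear derivation $\delta$ with $\delta(\{a,b\})=\{\delta(a),b\}+\{a,\delta(b)\}+\delta(a)\alpha(b)-\alpha(a)\delta(b)$. The Poisson-Ore extension $A[t;\alpha,\delta]_P$ is $A[t]$ with the Poisson bracket extending that of $A$ and satisfying $\{a,t\}=\alpha(a)t+\delta(a)$ for $a\in A$. Its bracket extends uniquely to the algebra $A(t)$ of rational functions with coefficients in $A$, giving $A(t;\alpha,\delta)_P$. Iterated extensions are formed by repeating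 the construction. Stratiform. An artinian Poisson algebra $S$ is Poisson stratiform over $\Bbbk$ if there is a chain of artinian Poisson algebras $S=S_n\supseteq S_{n-1}\supseteq\cdots\supseteq S_0=\Bbbk$ such that for every $i$ either $S_{i+1}$ is finite over $S_i$, or $S_{i+1}=S_i(t_i;\alpha_i,\delta_i)_P$ for some $\alpha_i,\delta_i$. A Poisson domain $A$ is Poisson stratiform if its field of fractions $Q(A)$, with the extended bracket, is Poisson stratiform. $A$ is strongly Poisson skew cancellative in the category of noetherian Poisson stratiform domains if for every $n\ge1$ and every noetherian Poisson stratiform domain $A'$, any Poisson isomorphism $A[t_1;\alpha_1,\delta_1]_P\cdots[t_n;\alpha_n,\delta_n]_P\cong A'[t_1';\alpha_1',\delta_1']_P\cdots[t_n';\alpha_n',\delta_n']_P$ implies a Poisson isomorphism $A\cong A'$. *)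

theory Defs
  imports "HOL-Algebra.Algebraic_Closure_Type" "HOL-Computational_Algebra.Computational_Algebra"
begin

text \<open>
  A Poisson algebra over the field \<open>'k\<close> is a type \<open>'a\<close> of class \<^class>\<open>comm_ring_1\<close> (or
  \<^class>\<open>idom\<close>, for a Poisson domain) with a scalar multiplication \<open>scale\<close> and a bracket \<open>br\<close>.
  Subalgebras, and the members of a chain of algebras, are subsets of such a type.
\<close>

section \<open>Poisson algebras\<close>

locale poisson_algebra = vector_space scale
  for scale :: "'k::field \<Rightarrow> 'a::comm_ring_1 \<Rightarrow> 'a" +
  fixes br :: "'a \<Rightarrow> 'a \<Rightarrow> 'a"
  assumes scale_mult: "scale k a * b = scale k (a * b)"
    and linear_left: "Vector_Spaces.linear scale scale (\<lambda>a. br a b)"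
    and linear_right: "Vector_Spaces.linear scale scale (\<lambda>b. br a b)"
    and alternating: "br a a = 0"
    and jacobi: "br a (br b c) + br b (br c a) + br c (br a b) = 0"
    and leibniz_left: "br (a * b) c = a * br b c + br a c * b"
    and leibniz_right: "br a (b * c) = br a b * c + b * br a c"

definition poisson_hom ::
  "('k::field \<Rightarrow> 'a::comm_ring_1 \<Rightarrow> 'a) \<Rightarrow> ('a \<Rightarrow> 'a \<Rightarrow> 'a) \<Rightarrow>
   ('k \<Rightarrow> 'b::comm_ring_1 \<Rightarrow> 'b) \<Rightarrow> ('b \<Rightarrow> 'b \<Rightarrow> 'b) \<Rightarrow> ('a \<Rightarrow> 'b) \<Rightarrow> bool" where
  "poisson_hom scale br scale' br' \<phi> \<longleftrightarrow>
     Vector_Spaces.linear scale scale' \<phi> \<and> \<phi> 1 = 1 \<and>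
     (\<forall>a b. \<phi> (a * b) = \<phi> a * \<phi> b) \<and> (\<forall>a b. \<phi> (br a b) = br' (\<phi> a) (\<phi> b))"

definition poisson_iso ::
  "('k::field \<Rightarrow> 'a::comm_ring_1 \<Rightarrow> 'a) \<Rightarrow> ('a \<Rightarrow> 'a \<Rightarrow> 'a) \<Rightarrow>
   ('k \<Rightarrow> 'b::comm_ring_1 \<Rightarrow> 'b) \<Rightarrow> ('b \<Rightarrow> 'b \<Rightarrow> 'b) \<Rightarrow> ('a \<Rightarrow> 'b) \<Rightarrow> bool" where
  "poisson_iso scale br scale' br' \<phi> \<longleftrightarrow> poisson_hom scale br scale' br' \<phi> \<and> bij \<phi>"

definition poisson_subalgebra ::
  "('k::field \<Rightarrow> 'a::comm_ring_1 \<Rightarrow> 'a) \<Rightarrow> ('a \<Rightarrow> 'a \<Rightarrow> 'a) \<Rightarrow> 'a set \<Rightarrow> bool" where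
  "poisson_subalgebra scale br R \<longleftrightarrow>
     0 \<in> R \<and> 1 \<in> R \<and> (\<forall>a\<in>R. \<forall>b\<in>R. a + b \<in> R) \<and> (\<forall>c. \<forall>a\<in>R. scale c a \<in> R) \<and>
     (\<forall>a\<in>R. \<forall>b\<in>R. a * b \<in> R) \<and> (\<forall>a\<in>R. \<forall>b\<in>R. br a b \<in> R)"


section \<open>The divisor subalgebra\<close>

definition Sw :: "'a::comm_ring_1 set \<Rightarrow> 'a set" where
  "Sw F = {g. \<exists>f\<in>F. f \<noteq> 0 \<and> (\<exists>b. f = g * b)}"

primrec divisor_stage ::
  "('k::field \<Rightarrow> 'a::comm_ring_1 \<Rightarrow> 'a) \<Rightarrow> ('a \<Rightarrow> 'a \<Rightarrow> 'a) \<Rightarrow> 'a set \<Rightarrow> nat \<Rightarrow> 'a set" where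
  "divisor_stage scale br F 0 = F"
| "divisor_stage scale br F (Suc n) =
     poisson_subalgebra scale br hull Sw (divisor_stage scale br F n)"

definition divisor_subalgebra ::
  "('k::field \<Rightarrow> 'a::comm_ring_1 \<Rightarrow> 'a) \<Rightarrow> ('a \<Rightarrow> 'a \<Rightarrow> 'a) \<Rightarrow> 'a set \<Rightarrow> 'a set" where
  "divisor_subalgebra scale br F = (\<Union>n. divisor_stage scale br F n)"


section \<open>Poisson-Ore extensions\<close>

text \<open>Only the values of a derivation of a subalgebra \<open>R\<close> on \<open>R\<close> itself matter.\<close>

definition derivation_on ::
  "('k::field \<Rightarrow> 'a::comm_ring_1 \<Rightarrow> 'a) \<Rightarrow> 'a set \<Rightarrow> ('a \<Rightarrow> 'a) \<Rightarrow> bool" where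
  "derivation_on scale R d \<longleftrightarrow>
     (\<forall>a\<in>R. d a \<in> R) \<and> (\<forall>a\<in>R. \<forall>b\<in>R. d (a + b) = d a + d b) \<and>
     (\<forall>c. \<forall>a\<in>R. d (scale c a) = scale c (d a)) \<and>
     (\<forall>a\<in>R. \<forall>b\<in>R. d (a * b) = d a * b + a * d b)"

definition poisson_derivation_on ::
  "('k::field \<Rightarrow> 'a::comm_ring_1 \<Rightarrow> 'a) \<Rightarrow> ('a \<Rightarrow> 'a \<Rightarrow> 'a) \<Rightarrow> 'a set \<Rightarrow> ('a \<Rightarrow> 'a) \<Rightarrow> bool" where
  "poisson_derivation_on scale br R \<alpha> \<longleftrightarrow> derivation_on scale R \<alpha> \<and>
     (\<forall>a\<in>R. \<forall>b\<in>R. \<alpha> (br a b) = br (\<alpha> a) b + br a (\<alpha> b))"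

definition poisson_skew_derivation_on ::
  "('k::field \<Rightarrow> 'a::comm_ring_1 \<Rightarrow> 'a) \<Rightarrow> ('a \<Rightarrow> 'a \<Rightarrow> 'a) \<Rightarrow> 'a set \<Rightarrow>
   ('a \<Rightarrow> 'a) \<Rightarrow> ('a \<Rightarrow> 'a) \<Rightarrow> bool" where
  "poisson_skew_derivation_on scale br R \<alpha> \<delta> \<longleftrightarrow> derivation_on scale R \<delta> \<and>
     (\<forall>a\<in>R. \<forall>b\<in>R. \<delta> (br a b) = br (\<delta> a) b + br a (\<delta> b) + \<delta> a * \<alpha> b - \<alpha> a * \<delta> b)"

definition polys_over :: "'a::comm_ring_1 set \<Rightarrow> 'a poly set" where
  "polys_over R = {p. \<forall>i. Polynomial.coeff p i \<in> R}"

definition ore_data ::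
  "('k::field \<Rightarrow> 'a::comm_ring_1 \<Rightarrow> 'a) \<Rightarrow> ('a \<Rightarrow> 'a \<Rightarrow> 'a) \<Rightarrow> 'a set \<Rightarrow> 'a \<Rightarrow>
   ('a \<Rightarrow> 'a) \<Rightarrow> ('a \<Rightarrow> 'a) \<Rightarrow> bool" where
  "ore_data scale br R t \<alpha> \<delta> \<longleftrightarrow>
     poisson_derivation_on scale br R \<alpha> \<and> poisson_skew_derivation_on scale br R \<alpha> \<delta> \<and>
     (\<forall>a\<in>R. br a t = \<alpha> a * t + \<delta> a)"

text \<open>
  The equation $R' = R[t;\alpha,\delta]_P$ for Poisson subalgebras \<open>R\<close> and \<open>R'\<close> of an ambient
  Poisson algebra: evaluation at \<open>t\<close> identifies the polynomial ring $R[t]$ with \<open>R'\<close>.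
\<close>

definition poisson_ore_extension ::
  "('k::field \<Rightarrow> 'a::comm_ring_1 \<Rightarrow> 'a) \<Rightarrow> ('a \<Rightarrow> 'a \<Rightarrow> 'a) \<Rightarrow> 'a set \<Rightarrow> 'a \<Rightarrow>
   ('a \<Rightarrow> 'a) \<Rightarrow> ('a \<Rightarrow> 'a) \<Rightarrow> 'a set \<Rightarrow> bool" where
  "poisson_ore_extension scale br R t \<alpha> \<delta> R' \<longleftrightarrow>
     poisson_subalgebra scale br R \<and> poisson_subalgebra scale br R' \<and>
     bij_betw (\<lambda>p. poly p t) (polys_over R) R' \<and> ore_data scale br R t \<alpha> \<delta>"

text \<open>
  The equation $R' = R(t;\alpha,\delta)_P$. Here $R(t)$ is the localization of $R[t]$ at its
  regular elements: evaluation at \<open>t\<close> is injective on $R[t]$, turns regular elements into units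
  of \<open>R'\<close>, and every element of \<open>R'\<close> is a quotient of two polynomials in \<open>t\<close>.
\<close>

definition regular_polys_over :: "'a::comm_ring_1 set \<Rightarrow> 'a poly set" where
  "regular_polys_over R = {q \<in> polys_over R. \<forall>p\<in>polys_over R. p * q = 0 \<longrightarrow> p = 0}"

definition rational_functions_over :: "'a::comm_ring_1 set \<Rightarrow> 'a \<Rightarrow> 'a set \<Rightarrow> bool" where
  "rational_functions_over R t R' \<longleftrightarrow>
     inj_on (\<lambda>p. poly p t) (polys_over R) \<and>
     (\<forall>q\<in>regular_polys_over R. \<exists>u\<in>R'. poly q t * u = 1) \<and>
     R' = {poly p t * u | p q u.
             p \<in> polys_over R \<and> q \<in> regular_polys_over R \<and> poly q t * u = 1}"

definition poisson_ore_rational_extension ::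
  "('k::field \<Rightarrow> 'a::comm_ring_1 \<Rightarrow> 'a) \<Rightarrow> ('a \<Rightarrow> 'a \<Rightarrow> 'a) \<Rightarrow> 'a set \<Rightarrow> 'a \<Rightarrow>
   ('a \<Rightarrow> 'a) \<Rightarrow> ('a \<Rightarrow> 'a) \<Rightarrow> 'a set \<Rightarrow> bool" where
  "poisson_ore_rational_extension scale br R t \<alpha> \<delta> R' \<longleftrightarrow>
     poisson_subalgebra scale br R \<and> poisson_subalgebra scale br R' \<and>
     rational_functions_over R t R' \<and> ore_data scale br R t \<alpha> \<delta>"

text \<open>
  The Poisson algebra \<open>(sB, brB)\<close> is, up to the embedding \<open>\<iota>\<close> of \<open>A = (scale, br)\<close>, an iterated
  Poisson-Ore extension $A[t_1;\alpha_1,\delta_1]_P\cdots[t_n;\alpha_n,\delta_n]_P$. The chain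
  \<open>C\<close> lists the intermediate extensions; each $\alpha_i,\delta_i$ is a map on the previous one.
\<close>

definition iterated_poisson_ore_extension ::
  "nat \<Rightarrow> ('k::field \<Rightarrow> 'a::comm_ring_1 \<Rightarrow> 'a) \<Rightarrow> ('a \<Rightarrow> 'a \<Rightarrow> 'a) \<Rightarrow> ('a \<Rightarrow> 'b) \<Rightarrow>
   ('k \<Rightarrow> 'b::comm_ring_1 \<Rightarrow> 'b) \<Rightarrow> ('b \<Rightarrow> 'b \<Rightarrow> 'b) \<Rightarrow> bool" where
  "iterated_poisson_ore_extension n scale br \<iota> sB brB \<longleftrightarrow>
     poisson_algebra sB brB \<and> poisson_hom scale br sB brB \<iota> \<and> inj \<iota> \<and>
     (\<exists>C t \<alpha> \<delta>. C 0 = range \<iota> \<and> C n = UNIV \<and>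
        (\<forall>i<n. poisson_ore_extension sB brB (C i) (t i) (\<alpha> i) (\<delta> i) (C (Suc i))))"


section \<open>Stratiform Poisson algebras\<close>

definition artinian_ring :: "('a, 'm) ring_scheme \<Rightarrow> bool" where
  "artinian_ring R \<longleftrightarrow> ring R \<and>
     (\<forall>I. (\<forall>n. ideal (I n) R \<and> I (Suc n) \<subseteq> I n) \<longrightarrow> (\<exists>N::nat. \<forall>n\<ge>N. I n = I N))"

abbreviation subring_of :: "'a::comm_ring_1 set \<Rightarrow> 'a ring" where
  "subring_of R \<equiv> ring_of_type_algebra\<lparr>carrier := R\<rparr>"

definition finite_over :: "'a::comm_ring_1 set \<Rightarrow> 'a set \<Rightarrow> bool" where
  "finite_over R R' \<longleftrightarrow> R \<subseteq> R' \<and>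
     (\<exists>G. finite G \<and> G \<subseteq> R' \<and> R' = {\<Sum>x\<in>G. c x * x | c. \<forall>x\<in>G. c x \<in> R})"

definition poisson_stratiform ::
  "('k::field \<Rightarrow> 'a::comm_ring_1 \<Rightarrow> 'a) \<Rightarrow> ('a \<Rightarrow> 'a \<Rightarrow> 'a) \<Rightarrow> bool" where
  "poisson_stratiform scale br \<longleftrightarrow> poisson_algebra scale br \<and>
     (\<exists>n S. S n = UNIV \<and> S 0 = range (\<lambda>c. scale c 1) \<and>
        (\<forall>i\<le>n. poisson_subalgebra scale br (S i) \<and> artinian_ring (subring_of (S i))) \<and>
        (\<forall>i<n. finite_over (S i) (S (Suc i)) \<or>
               (\<exists>t \<alpha> \<delta>. poisson_ore_rational_extension scale br (S i) t \<alpha> \<delta> (S (Suc i)))))"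


section \<open>The field of fractions of a Poisson domain\<close>

definition fract_scale :: "('k::field \<Rightarrow> 'a::idom \<Rightarrow> 'a) \<Rightarrow> 'k \<Rightarrow> 'a fract \<Rightarrow> 'a fract" where
  "fract_scale scale c x = Fract (scale c 1) 1 * x"

text \<open>
  The value of $\{a/b, c/d\}$ forced by the Leibniz rule. For a Poisson bracket \<open>br\<close> it does not
  depend on the representing fractions, and it is the only Poisson bracket on the field of
  fractions that extends \<open>br\<close>; see \<open>fract_bracket_Fract\<close> to \<open>fract_bracket_unique\<close> below.
\<close>

definition fract_bracket_rep ::
  "('a::idom \<Rightarrow> 'a \<Rightarrow> 'a) \<Rightarrow> 'a \<times> 'a \<Rightarrow> 'a \<times> 'a \<Rightarrow> 'a fract" where
  "fract_bracket_rep br = (\<lambda>(a, b) (c, d).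
     Fract (b * d * br a c - a * d * br b c - b * c * br a d + a * c * br b d) (b\<^sup>2 * d\<^sup>2))"

definition fract_rep :: "'a::idom fract \<Rightarrow> 'a \<times> 'a" where
  "fract_rep x = (SOME r. snd r \<noteq> 0 \<and> x = Fract (fst r) (snd r))"

definition fract_bracket :: "('a::idom \<Rightarrow> 'a \<Rightarrow> 'a) \<Rightarrow> 'a fract \<Rightarrow> 'a fract \<Rightarrow> 'a fract" where
  "fract_bracket br x y = fract_bracket_rep br (fract_rep x) (fract_rep y)"

lemma fract_rep: "snd (fract_rep x) \<noteq> 0" "Fract (fst (fract_rep x)) (snd (fract_rep x)) = x"
proof -
  have "\<exists>r. snd r \<noteq> 0 \<and> x = Fract (fst r) (snd r)"
    by (cases x) auto
  from someI_ex[OF this]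
  show "snd (fract_rep x) \<noteq> 0" "Fract (fst (fract_rep x)) (snd (fract_rep x)) = x"
    by (simp_all add: fract_rep_def)
qed

context
  fixes scale :: "'k::field \<Rightarrow> 'a::idom \<Rightarrow> 'a" and br :: "'a \<Rightarrow> 'a \<Rightarrow> 'a"
  assumes P: "poisson_algebra scale br"
begin

interpretation poisson_algebra scale br by (fact P)

lemma br_add_left: "br (a + b) c = br a c + br b c"
  using linear_left[of c] by (simp add: Vector_Spaces.linear_iff)

lemma br_add_right: "br a (b + c) = br a b + br a c"
  using linear_right[of a] by (simp add: Vector_Spaces.linear_iff)

lemma br_scale_left: "br (scale k a) c = scale k (br a c)"
  using linear_left[of c] by (simp add: Vector_Spaces.linear_iff)

lemma br_scale_right: "br a (scale k c) = scale k (br a c)"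
  using linear_right[of a] by (simp add: Vector_Spaces.linear_iff)

lemma br_antisym: "br a b = - br b a"
proof -
  have "br (a + b) (a + b) = 0"
    by (rule alternating)
  then have "br a b + br b a = 0"
    unfolding br_add_left br_add_right by (simp add: alternating add.commute)
  then show ?thesis
    by (simp add: eq_neg_iff_add_eq_0)
qed

lemma br_zero_left [simp]: "br 0 c = 0"
  by (metis br_add_left add_0 add_cancel_right_right)

lemma br_one_left [simp]: "br 1 c = 0"
  by (metis leibniz_left mult_1 mult_1_right add_cancel_right_right)

lemma fract_bracket_rep_cong:
  assumes nz: "b \<noteq> 0" "b' \<noteq> 0" "d \<noteq> 0" and eq: "a * b' = a' * b"
  shows "fract_bracket_rep br (a, b) (c, d) = fract_bracket_rep br (a', b') (c, d)"
proof -
  have E: "(b * br a x - a * br b x) * b'\<^sup>2 = (b' * br a' x - a' * br b' x) * b\<^sup>2" for x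
  proof -
    have L: "a * br b' x + br a x * b' = a' * br b x + br a' x * b"
      using arg_cong[OF eq, of "\<lambda>y. br y x"] by (simp add: leibniz_left)
    have "(b * br a x - a * br b x) * b'\<^sup>2 - (b' * br a' x - a' * br b' x) * b\<^sup>2
        = b * b' * ((a * br b' x + br a x * b') - (a' * br b x + br a' x * b))
          - (b * br b' x + b' * br b x) * (a * b' - a' * b)"
      by (simp add: algebra_simps power2_eq_square)
    then show ?thesis
      by (simp add: L eq)
  qed
  have "(b * d * br a c - a * d * br b c - b * c * br a d + a * c * br b d) * (b'\<^sup>2 * d\<^sup>2)
      = (d * ((b * br a c - a * br b c) * b'\<^sup>2) - c * ((b * br a d - a * br b d) * b'\<^sup>2)) * d\<^sup>2"
    by (simp add: algebra_simps)
  also have "\<dots> = (d * ((b' * br a' c - a' * br b' c) * b\<^sup>2)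
      - c * ((b' * br a' d - a' * br b' d) * b\<^sup>2)) * d\<^sup>2"
    by (simp only: E)
  also have "\<dots> = (b' * d * br a' c - a' * d * br b' c - b' * c * br a' d + a' * c * br b' d)
      * (b\<^sup>2 * d\<^sup>2)"
    by (simp add: algebra_simps)
  finally show ?thesis
    using nz by (simp add: fract_bracket_rep_def eq_fract)
qed

lemma fract_bracket_rep_swap:
  "fract_bracket_rep br (a, b) (c, d) = - fract_bracket_rep br (c, d) (a, b)"
proof -
  have "b * d * br a c - a * d * br b c - b * c * br a d + a * c * br b d =
      - (d * b * br c a - c * b * br d a - d * a * br c b + c * a * br d b)"
    using br_antisym[of a c] br_antisym[of b c] br_antisym[of a d] br_antisym[of b d]
    by (simp add: algebra_simps)
  then show ?thesis
    by (simp add: fract_bracket_rep_def mult.commute)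
qed

lemma fract_bracket_Fract:
  assumes "b \<noteq> 0" "d \<noteq> 0"
  shows "fract_bracket br (Fract a b) (Fract c d) =
    Fract (b * d * br a c - a * d * br b c - b * c * br a d + a * c * br b d) (b\<^sup>2 * d\<^sup>2)"
proof -
  obtain a' b' where x: "fract_rep (Fract a b) = (a', b')" by force
  obtain c' d' where y: "fract_rep (Fract c d) = (c', d')" by force
  have b': "b' \<noteq> 0" and xx: "Fract a' b' = Fract a b"
    using fract_rep[of "Fract a b"] by (simp_all add: x)
  have d': "d' \<noteq> 0" and yy: "Fract c' d' = Fract c d"
    using fract_rep[of "Fract c d"] by (simp_all add: y)
  have e1: "a' * b = a * b'" and e2: "c' * d = c * d'"
    using xx yy b' d' assms by (simp_all add: eq_fract)
  have "fract_bracket br (Fract a b) (Fract c d) = fract_bracket_rep br (a', b') (c', d')"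
    by (simp add: fract_bracket_def x y)
  also have "\<dots> = fract_bracket_rep br (a, b) (c', d')"
    by (rule fract_bracket_rep_cong) (use b' d' assms e1 in auto)
  also have "\<dots> = - fract_bracket_rep br (c', d') (a, b)"
    by (rule fract_bracket_rep_swap)
  also have "\<dots> = - fract_bracket_rep br (c, d) (a, b)"
    by (subst fract_bracket_rep_cong[of d' d b c' c]) (use b' d' assms e2 in auto)
  also have "\<dots> = fract_bracket_rep br (a, b) (c, d)"
    by (rule fract_bracket_rep_swap[symmetric])
  finally show ?thesis
    by (simp add: fract_bracket_rep_def)
qed

lemma br_one_right [simp]: "br c 1 = 0"
  by (subst br_antisym) simp

lemma fract_bracket_extends: "fract_bracket br (Fract a 1) (Fract b 1) = Fract (br a b) 1"
  by (simp add: fract_bracket_Fract)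

lemma Fract_add_same: "b \<noteq> 0 \<Longrightarrow> Fract (a::'a) b + Fract a' b = Fract (a + a') b"
  by (simp add: eq_fract algebra_simps)

lemma fract_bracket_antisym: "fract_bracket br x y = - fract_bracket br y x"
  unfolding fract_bracket_def by (metis fract_bracket_rep_swap prod.collapse)

lemma fract_bracket_add_left:
  "fract_bracket br (x + x') y = fract_bracket br x y + fract_bracket br x' y"
proof -
  obtain a b where x: "x = Fract a b" "b \<noteq> 0" by (cases x) auto
  obtain a1 b1 where x1: "x' = Fract a1 b1" "b1 \<noteq> 0" by (cases x') auto
  obtain c d where y: "y = Fract c d" "d \<noteq> 0" by (cases y) auto
  have N: "x = Fract (a * b1) (b * b1)" and N1: "x' = Fract (a1 * b) (b * b1)"
    using x x1 by (simp_all add: eq_fract algebra_simps)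
  have nz: "b * b1 \<noteq> 0" using x x1 by simp
  have S: "x + x' = Fract (a * b1 + a1 * b) (b * b1)"
    by (simp add: N N1 Fract_add_same[OF nz])
  have nz2: "(b * b1)\<^sup>2 * d\<^sup>2 \<noteq> 0" using nz y by simp
  show ?thesis
    unfolding S unfolding N N1 y(1) fract_bracket_Fract[OF nz y(2)] Fract_add_same[OF nz2]
    by (simp add: br_add_left algebra_simps)
qed

lemma fract_bracket_mult_left:
  "fract_bracket br (x * x') y = x * fract_bracket br x' y + fract_bracket br x y * x'"
proof -
  obtain a b where x: "x = Fract a b" "b \<noteq> 0" by (cases x) auto
  obtain a1 b1 where x1: "x' = Fract a1 b1" "b1 \<noteq> 0" by (cases x') auto
  obtain c d where y: "y = Fract c d" "d \<noteq> 0" by (cases y) auto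
  have nz: "b * b1 \<noteq> 0" using x x1 by simp
  have "x * fract_bracket br x' y =
      Fract (a * b * (b1 * d * br a1 c - a1 * d * br b1 c - b1 * c * br a1 d + a1 * c * br b1 d))
        ((b * b1)\<^sup>2 * d\<^sup>2)"
    using x x1 y by (simp add: fract_bracket_Fract eq_fract power2_eq_square algebra_simps)
  moreover have "fract_bracket br x y * x' =
      Fract (a1 * b1 * (b * d * br a c - a * d * br b c - b * c * br a d + a * c * br b d))
        ((b * b1)\<^sup>2 * d\<^sup>2)"
    using x x1 y by (simp add: fract_bracket_Fract eq_fract power2_eq_square algebra_simps)
  moreover have nz2: "(b * b1)\<^sup>2 * d\<^sup>2 \<noteq> 0" using nz y by simp
  ultimately show ?thesis
    apply (simp only: Fract_add_same[OF nz2])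
    apply (simp add: x x1 y fract_bracket_Fract leibniz_left)
    apply (simp add: algebra_simps)
    done
qed

lemma fract_derivation_eq_0:
  fixes D :: "'a fract \<Rightarrow> 'a fract"
  assumes "\<And>x y. D (x * y) = x * D y + D x * y" and "\<And>a. D (Fract a 1) = 0"
  shows "D x = 0"
proof -
  obtain a b where x: "x = Fract a b" "b \<noteq> 0" by (cases x) auto
  have "x * Fract b 1 = Fract a 1"
    using x by (simp add: eq_fract)
  then have "D x * Fract b 1 = 0"
    using assms(1)[of x "Fract b 1"] by (simp add: assms(2))
  moreover have "Fract b 1 \<noteq> 0"
    using x by (simp add: Zero_fract_def eq_fract)
  ultimately show ?thesis by simp
qed

lemma fract_bracket_add_right:
  "fract_bracket br y (x + x') = fract_bracket br y x + fract_bracket br y x'"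
  by (subst (1 2 3) fract_bracket_antisym) (simp add: fract_bracket_add_left)

lemma fract_bracket_mult_right:
  "fract_bracket br y (x * x') = fract_bracket br y x * x' + x * fract_bracket br y x'"
  by (subst (1 2 3) fract_bracket_antisym) (simp add: fract_bracket_mult_left)

lemma fract_bracket_jacobi:
  "fract_bracket br x (fract_bracket br y z) + fract_bracket br y (fract_bracket br z x)
    + fract_bracket br z (fract_bracket br x y) = 0"
proof -
  let ?B = "fract_bracket br"
  define J where "J x y z = ?B x (?B y z) + ?B y (?B z x) + ?B z (?B x y)" for x y z
  have minus_right: "?B u (- v) = - ?B u v" for u v
    using fract_bracket_add_right[of u v "- v"] fract_bracket_add_right[of u 0 0]
    by (simp add: eq_neg_iff_add_eq_0 add.commute)
  have der: "J (x * x') y z = x * J x' y z + J x y z * x'" for x x' y z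
  proof -
    have a: "?B (x * x') (?B y z) = x * ?B x' (?B y z) + ?B x (?B y z) * x'"
      by (rule fract_bracket_mult_left)
    have b: "?B y (?B z (x * x')) = ?B y (?B z x) * x' + ?B z x * ?B y x'
        + (?B y x * ?B z x' + x * ?B y (?B z x'))"
      by (simp add: fract_bracket_mult_right fract_bracket_add_right)
    have c: "?B z (?B (x * x') y) = ?B z x * ?B x' y + x * ?B z (?B x' y)
        + (?B z (?B x y) * x' + ?B x y * ?B z x')"
      by (simp add: fract_bracket_mult_right fract_bracket_mult_left fract_bracket_add_right)
    show ?thesis
      unfolding J_def a b c fract_bracket_antisym[of x' y] fract_bracket_antisym[of x y]
      by (simp add: algebra_simps minus_right)
  qed
  have cyc: "J x y z = J y z x" for x y z
    by (simp add: J_def algebra_simps)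
  have J0: "J (Fract a 1) (Fract b 1) (Fract c 1) = 0" for a b c
  proof -
    have "J (Fract a 1) (Fract b 1) (Fract c 1)
        = Fract (br a (br b c) + br b (br c a) + br c (br a b)) 1"
      unfolding J_def fract_bracket_extends by (simp add: Fract_add_same)
    then show ?thesis
      by (simp add: jacobi Zero_fract_def)
  qed
  have J1: "J x (Fract b 1) (Fract c 1) = 0" for x b c
    using fract_derivation_eq_0[of "\<lambda>x. J x (Fract b 1) (Fract c 1)" x] der J0 by blast
  have J2: "J x y (Fract c 1) = 0" for x y c
    unfolding cyc[of x]
    using fract_derivation_eq_0[of "\<lambda>y. J y (Fract c 1) x" y] der J1 cyc by metis
  have "J x y z = 0"
    unfolding cyc[of x] cyc[of y]
    using fract_derivation_eq_0[of "\<lambda>z. J z x y" z] der J2 cyc by metis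
  then show ?thesis
    by (simp add: J_def)
qed

lemma fract_bracket_alternating: "fract_bracket br x x = 0"
proof -
  obtain a b where x: "x = Fract a b" "b \<noteq> 0" by (cases x) auto
  have "b * b * br a a - a * b * br b a - b * a * br a b + a * a * br b b = 0"
    using br_antisym[of a b] by (simp add: alternating algebra_simps)
  then show ?thesis
    using x by (simp add: fract_bracket_Fract fract_collapse)
qed

theorem poisson_algebra_fract: "poisson_algebra (fract_scale scale) (fract_bracket br)"
proof -
  have scale_eq: "scale c a = scale c 1 * a" for c a
    using scale_mult[of c 1 a] by simp
  have vs: "vector_space (fract_scale scale)"
  proof (unfold_locales, goal_cases)
    case (2 c d x)
    show ?case
      by (simp add: fract_scale_def scale_left_distrib distrib_right flip: Fract_add_same
          del: add_fract)
  next
    case (3 c d x)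
    then show ?case
      using scale_eq[of c "scale d 1"] by (simp add: fract_scale_def mult.assoc[symmetric])
  qed (simp_all add: fract_scale_def distrib_left One_fract_def[symmetric])
  have br_scale_one: "br (scale c 1) a = 0" for c a
    by (simp add: br_scale_left)
  have zero: "fract_bracket br (Fract (scale c 1) 1) y = 0" for c y
  proof -
    have "fract_bracket br y (Fract (scale c 1) 1) = 0"
      by (rule fract_derivation_eq_0[of "\<lambda>y. fract_bracket br y (Fract (scale c 1) 1)"])
        (simp_all add: fract_bracket_mult_left fract_bracket_extends br_scale_right
          fract_collapse)
    then show ?thesis
      by (subst fract_bracket_antisym) simp
  qed
  have lin_left: "fract_bracket br (fract_scale scale c x) y
      = fract_scale scale c (fract_bracket br x y)" for c x y
    by (simp add: fract_scale_def fract_bracket_mult_left zero)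
  have lin_right: "fract_bracket br y (fract_scale scale c x)
      = fract_scale scale c (fract_bracket br y x)" for c x y
    by (subst (1 2) fract_bracket_antisym) (simp add: lin_left, simp add: fract_scale_def)
  show ?thesis
    by (intro poisson_algebra.intro poisson_algebra_axioms.intro vs)
      (simp_all add: Vector_Spaces.linear_iff vs fract_bracket_add_left fract_bracket_add_right
        lin_left lin_right fract_bracket_mult_left fract_bracket_mult_right
        fract_bracket_jacobi fract_bracket_alternating,
        simp_all add: fract_scale_def mult.assoc)
qed

theorem fract_bracket_unique:
  assumes Q: "poisson_algebra (fract_scale scale) B"
    and ext: "\<And>a b. B (Fract a 1) (Fract b 1) = Fract (br a b) 1"
  shows "B = fract_bracket br"
proof -
  let ?F = "fract_bracket br"
  interpret Q: poisson_algebra "fract_scale scale" B by (fact Q)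
  have 1: "B x (Fract b 1) - ?F x (Fract b 1) = 0" for x b
    by (rule fract_derivation_eq_0[of "\<lambda>x. B x (Fract b 1) - ?F x (Fract b 1)"])
      (simp_all add: Q.leibniz_left fract_bracket_mult_left ext fract_bracket_extends
        algebra_simps)
  have "B x y - ?F x y = 0" for x y
    by (rule fract_derivation_eq_0[of "\<lambda>y. B x y - ?F x y"])
      (use 1 in \<open>simp_all add: Q.leibniz_right fract_bracket_mult_right algebra_simps\<close>)
  then show ?thesis
    by (simp add: fun_eq_iff)
qed

end

definition poisson_stratiform_domain ::
  "('k::field \<Rightarrow> 'a::idom \<Rightarrow> 'a) \<Rightarrow> ('a \<Rightarrow> 'a \<Rightarrow> 'a) \<Rightarrow> bool" where
  "poisson_stratiform_domain scale br \<longleftrightarrow> poisson_algebra scale br \<and>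
     poisson_stratiform (fract_scale scale) (fract_bracket br)"

definition noetherian_poisson_stratiform_domain ::
  "('k::field \<Rightarrow> 'a::idom \<Rightarrow> 'a) \<Rightarrow> ('a \<Rightarrow> 'a \<Rightarrow> 'a) \<Rightarrow> bool" where
  "noetherian_poisson_stratiform_domain scale br \<longleftrightarrow>
     noetherian_ring (ring_of_type_algebra :: 'a ring) \<and> poisson_stratiform_domain scale br"


section \<open>Skew cancellation\<close>

text \<open>
  The type arguments are the carrier types of the competing domain \<open>A'\<close> and of the two iterated
  extensions. They stand in for quantification over types, which is not available inside a
  formula: a theorem about \<open>strongly_poisson_skew_cancellative\<close> has to leave them arbitrary.
\<close>

definition strongly_poisson_skew_cancellative ::
  "'b::idom itself \<Rightarrow> 'c::comm_ring_1 itself \<Rightarrow> 'd::comm_ring_1 itself \<Rightarrow>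
   ('k::field \<Rightarrow> 'a::idom \<Rightarrow> 'a) \<Rightarrow> ('a \<Rightarrow> 'a \<Rightarrow> 'a) \<Rightarrow> bool" where
  "strongly_poisson_skew_cancellative _ _ _ scale br \<longleftrightarrow>
     (\<forall>n\<ge>1. \<forall>(scale' :: 'k \<Rightarrow> 'b \<Rightarrow> 'b) br'. noetherian_poisson_stratiform_domain scale' br' \<longrightarrow>
       (\<forall>(sB :: 'k \<Rightarrow> 'c \<Rightarrow> 'c) brB \<iota> (sB' :: 'k \<Rightarrow> 'd \<Rightarrow> 'd) brB' \<iota>'.
          iterated_poisson_ore_extension n scale br \<iota> sB brB \<longrightarrow>
          iterated_poisson_ore_extension n scale' br' \<iota>' sB' brB' \<longrightarrow>
          (\<exists>\<phi>. poisson_iso sB brB sB' brB' \<phi>) \<longrightarrow>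
          (\<exists>\<psi>. poisson_iso scale br scale' br' \<psi>)))"

end

theory Submission
  imports Defs
begin

text \<open>
  Let \<open>B = A[t\<^sub>1;\<dots>]\<^sub>P\<cdots>[t\<^sub>n;\<dots>]\<^sub>P\<close> and \<open>B' = A'[t'\<^sub>1;\<dots>]\<^sub>P\<cdots>[t'\<^sub>n;\<dots>]\<^sub>P\<close> be iterated extensions
  and \<open>\<phi> : B \<rightarrow> B'\<close> a Poisson isomorphism. The claim is that \<open>\<phi>\<close> already maps \<open>A\<close> onto \<open>A'\<close>. The
  brackets enter only through the inclusion \<open>\<phi>(A) \<subseteq> A'\<close>; that this inclusion is an equality is a
  fact about polynomial rings in the same number of variables, the smaller coefficient ring being
  noetherian.

  Inclusion. As \<open>A'\<close> is a domain, degrees add in \<open>B'\<close>, so a divisor in \<open>B'\<close> of a nonzero element of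
  \<open>A'\<close> lies in \<open>A'\<close> (\<open>polynomial_tower_divisor_in_base\<close>). Hence the preimage of \<open>A'\<close> in \<open>A\<close> is a
  Poisson subalgebra closed under taking divisors of its nonzero elements, and it contains 1. Such a
  subalgebra contains the divisor subalgebra of 1 (\<open>divisor_subalgebra_minimal\<close>), which is all of
  \<open>A\<close>.

  Equality (\<open>polynomial_tower_base_rigid\<close>). Identify \<open>B\<close> with \<open>B'\<close>, so that \<open>A \<subseteq> A'\<close> and
  \<open>A[t\<^sub>1,\<dots>,t\<^sub>n] = A'[t'\<^sub>1,\<dots>,t'\<^sub>n] = B\<close>. Let \<open>\<pi> : B \<rightarrow> A\<close> be the retraction that kills all \<open>t\<^sub>i\<close>. The ring
  homomorphism \<open>g : B \<rightarrow> B\<close> that agrees with \<open>\<pi>\<close> on \<open>A'\<close> and sends \<open>t'\<^sub>i\<close> to \<open>t\<^sub>i\<close> is surjective, since its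
  image contains \<open>\<pi>(A) = A\<close> and all \<open>t\<^sub>i\<close>. By the Hilbert basis theorem (\<open>hilbert_basis\<close>) \<open>B\<close> is
  noetherian, and a surjective endomorphism of a noetherian ring is injective
  (\<open>surjective_endomorphism_inj\<close>). So \<open>\<pi>\<close> is injective on \<open>A'\<close>. For \<open>y \<in> A'\<close> both \<open>y\<close> and
  \<open>\<pi>(y) \<in> A \<subseteq> A'\<close> have the same image under \<open>\<pi>\<close>, whence \<open>y = \<pi>(y) \<in> A\<close>.
\<close>

section \<open>Subrings, ideals and homomorphisms on subsets\<close>

definition unital_subring :: "'a::comm_ring_1 set \<Rightarrow> bool" where
  "unital_subring R \<longleftrightarrow> 1 \<in> R \<and> (\<forall>a\<in>R. - a \<in> R) \<and>
     (\<forall>a\<in>R. \<forall>b\<in>R. a + b \<in> R) \<and> (\<forall>a\<in>R. \<forall>b\<in>R. a * b \<in> R)"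

text \<open>
  A homomorphism defined on \<open>R\<close> only; its values outside \<open>R\<close> are arbitrary. This lets a homomorphism
  be extended from a ring to the next one of a chain of subsets of a single type.
\<close>

definition unital_hom_on :: "'a::comm_ring_1 set \<Rightarrow> ('a \<Rightarrow> 'b::comm_ring_1) \<Rightarrow> bool" where
  "unital_hom_on R h \<longleftrightarrow> h 1 = 1 \<and>
     (\<forall>a\<in>R. \<forall>b\<in>R. h (a + b) = h a + h b) \<and> (\<forall>a\<in>R. \<forall>b\<in>R. h (a * b) = h a * h b)"

definition ideal_within :: "'a::comm_ring_1 set \<Rightarrow> 'a set \<Rightarrow> bool" where
  "ideal_within R I \<longleftrightarrow> I \<subseteq> R \<and> 0 \<in> I \<and> (\<forall>a\<in>I. \<forall>b\<in>I. a + b \<in> I) \<and>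
     (\<forall>r\<in>R. \<forall>a\<in>I. r * a \<in> I)"

definition acc_on_ideals :: "'a::comm_ring_1 set \<Rightarrow> bool" where
  "acc_on_ideals R \<longleftrightarrow>
     (\<forall>I. (\<forall>n. ideal_within R (I n)) \<and> incseq I \<longrightarrow> (\<exists>N. \<forall>n\<ge>N. I n = I N))"

definition no_zero_divisors_in :: "'a::comm_ring_1 set \<Rightarrow> bool" where
  "no_zero_divisors_in R \<longleftrightarrow> (\<forall>a\<in>R. \<forall>b\<in>R. a * b = 0 \<longrightarrow> a = 0 \<or> b = 0)"

lemma unital_subringD:
  assumes "unital_subring R"
  shows "1 \<in> R" "0 \<in> R"
    and "a \<in> R \<Longrightarrow> - a \<in> R"
    and "a \<in> R \<Longrightarrow> b \<in> R \<Longrightarrow> a + b \<in> R"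
    and "a \<in> R \<Longrightarrow> b \<in> R \<Longrightarrow> a - b \<in> R"
    and "a \<in> R \<Longrightarrow> b \<in> R \<Longrightarrow> a * b \<in> R"
proof -
  show one: "1 \<in> R" and neg: "\<And>a. a \<in> R \<Longrightarrow> - a \<in> R"
    and add: "\<And>a b. a \<in> R \<Longrightarrow> b \<in> R \<Longrightarrow> a + b \<in> R"
    and "a \<in> R \<Longrightarrow> b \<in> R \<Longrightarrow> a * b \<in> R"
    using assms by (auto simp: unital_subring_def)
  show "0 \<in> R"
    using add[OF one neg[OF one]] by simp
  show "a \<in> R \<Longrightarrow> b \<in> R \<Longrightarrow> a - b \<in> R"
    using add[OF _ neg, of a b] by simp
qed

lemma unital_subring_UNIV: "unital_subring UNIV"
  by (simp add: unital_subring_def)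

lemma unital_subring_sum:
  assumes "unital_subring R" "\<And>i. i \<in> J \<Longrightarrow> f i \<in> R"
  shows "sum f J \<in> R"
  using assms(2)
  by (induction J rule: infinite_finite_induct) (auto intro: unital_subringD[OF assms(1)])

lemma unital_hom_onD:
  assumes "unital_hom_on R h"
  shows "h 1 = 1"
    and "a \<in> R \<Longrightarrow> b \<in> R \<Longrightarrow> h (a + b) = h a + h b"
    and "a \<in> R \<Longrightarrow> b \<in> R \<Longrightarrow> h (a * b) = h a * h b"
  using assms by (auto simp: unital_hom_on_def)

lemma unital_hom_on_0:
  assumes "unital_subring R" "unital_hom_on R h"
  shows "h 0 = 0"
  using unital_hom_onD(2)[OF assms(2), of 0 0] unital_subringD(2)[OF assms(1)] by simp

lemma unital_hom_on_minus:
  assumes "unital_subring R" "unital_hom_on R h" "a \<in> R"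
  shows "h (- a) = - h a"
proof -
  have "h a + h (- a) = 0"
    using unital_hom_onD(2)[OF assms(2,3) unital_subringD(3)[OF assms(1,3)]]
    by (simp add: unital_hom_on_0[OF assms(1,2)])
  then show ?thesis
    by (metis add_eq_0_iff)
qed

lemma unital_hom_on_sum:
  assumes "unital_subring R" "unital_hom_on R h" "\<And>i. i \<in> J \<Longrightarrow> f i \<in> R"
  shows "h (sum f J) = (\<Sum>i\<in>J. h (f i))"
  using assms(3)
  by (induction J rule: infinite_finite_induct)
    (auto simp: unital_hom_on_0[OF assms(1,2)] unital_hom_onD(2)[OF assms(2)]
      unital_subring_sum[OF assms(1)])

lemma unital_subring_image:
  assumes R: "unital_subring R" and h: "unital_hom_on R h"
  shows "unital_subring (h ` R)"
  unfolding unital_subring_def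
proof (intro conjI ballI)
  show "1 \<in> h ` R"
    using unital_hom_onD(1)[OF h] unital_subringD(1)[OF R] by (metis imageI)
next
  fix a assume "a \<in> h ` R"
  then obtain x where x: "x \<in> R" and a: "a = h x" by blast
  show "- a \<in> h ` R"
    unfolding a unital_hom_on_minus[OF R h x, symmetric] using unital_subringD(3)[OF R x] by blast
next
  fix a b assume "a \<in> h ` R" "b \<in> h ` R"
  then obtain x y where xy: "x \<in> R" "y \<in> R" and ab: "a = h x" "b = h y" by blast
  show "a + b \<in> h ` R"
    unfolding ab unital_hom_onD(2)[OF h xy, symmetric] using unital_subringD(4)[OF R xy] by blast
  show "a * b \<in> h ` R"
    unfolding ab unital_hom_onD(3)[OF h xy, symmetric] using unital_subringD(6)[OF R xy] by blast
qed

lemma unital_subring_vimage: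
  assumes R: "unital_subring R" and h: "unital_hom_on R h" and S: "unital_subring S"
  shows "unital_subring {x \<in> R. h x \<in> S}"
  unfolding unital_subring_def
  by (auto simp: unital_hom_onD[OF h] unital_hom_on_minus[OF R h]
      intro: unital_subringD[OF R] unital_subringD[OF S])


section \<open>Polynomials with coefficients in a subring\<close>

lemma polys_over_0: "unital_subring R \<Longrightarrow> 0 \<in> polys_over R"
  by (simp add: polys_over_def unital_subringD)

lemma polys_over_pCons:
  "pCons a p \<in> polys_over R \<longleftrightarrow> a \<in> R \<and> p \<in> polys_over R"
  by (auto simp: polys_over_def coeff_pCons split: nat.splits)

lemma polys_over_add:
  "unital_subring R \<Longrightarrow> p \<in> polys_over R \<Longrightarrow> q \<in> polys_over R \<Longrightarrow> p + q \<in> polys_over R"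
  by (simp add: polys_over_def unital_subringD)

lemma polys_over_diff:
  "unital_subring R \<Longrightarrow> p \<in> polys_over R \<Longrightarrow> q \<in> polys_over R \<Longrightarrow> p - q \<in> polys_over R"
  by (simp add: polys_over_def unital_subringD)

lemma polys_over_mult:
  assumes "unital_subring R" "p \<in> polys_over R" "q \<in> polys_over R"
  shows "p * q \<in> polys_over R"
  using assms
  by (auto simp: polys_over_def coeff_mult intro!: unital_subring_sum unital_subringD(6))

lemma polys_over_const: "unital_subring R \<Longrightarrow> a \<in> R \<Longrightarrow> [:a:] \<in> polys_over R"
  by (simp add: polys_over_pCons polys_over_0)

lemma polys_over_var: "unital_subring R \<Longrightarrow> [:0, 1:] \<in> polys_over R"
  by (simp add: polys_over_pCons polys_over_0 unital_subringD)

lemma poly_in_subring: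
  assumes S: "unital_subring S" and "R \<subseteq> S" "t \<in> S" "p \<in> polys_over R"
  shows "poly p t \<in> S"
  using assms(4)
proof (induction p)
  case 0
  then show ?case using S by (simp add: unital_subringD)
next
  case (pCons a p)
  then show ?case
    using assms(2,3) by (auto simp: polys_over_pCons intro!: unital_subringD[OF S])
qed

lemma degree_mult_polys_over:
  assumes "no_zero_divisors_in R" "p \<in> polys_over R" "q \<in> polys_over R" "p \<noteq> 0" "q \<noteq> 0"
  shows "p * q \<noteq> 0" "Polynomial.degree (p * q) = Polynomial.degree p + Polynomial.degree q"
proof -
  have "Polynomial.coeff (p * q) (Polynomial.degree p + Polynomial.degree q) \<noteq> 0"
    unfolding coeff_mult_degree_sum
    using assms unfolding no_zero_divisors_in_def polys_over_def mem_Collect_eq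
    by (metis leading_coeff_0_iff)
  then show "p * q \<noteq> 0"
    "Polynomial.degree (p * q) = Polynomial.degree p + Polynomial.degree q"
    by (auto intro: antisym degree_mult_le le_degree)
qed

text \<open>
  The ring-theoretic part of a Poisson-Ore extension \<open>R' = R[t;\<alpha>,\<delta>]\<^sub>P\<close>.
\<close>

definition polynomial_ring :: "'a::comm_ring_1 set \<Rightarrow> 'a \<Rightarrow> 'a set \<Rightarrow> bool" where
  "polynomial_ring R t R' \<longleftrightarrow> unital_subring R \<and> unital_subring R' \<and>
     bij_betw (\<lambda>p. poly p t) (polys_over R) R'"

lemma polynomial_ringD:
  assumes "polynomial_ring R t R'"
  shows "unital_subring R" "unital_subring R'"
    and "p \<in> polys_over R \<Longrightarrow> poly p t \<in> R'"
    and "p \<in> polys_over R \<Longrightarrow> q \<in> polys_over R \<Longrightarrow> poly p t = poly q t \<Longrightarrow> p = q"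
  using assms by (auto simp: polynomial_ring_def bij_betw_def dest: inj_onD)

lemma polynomial_ringE:
  assumes "polynomial_ring R t R'" "x \<in> R'"
  obtains p where "p \<in> polys_over R" "x = poly p t"
  using assms by (auto simp: polynomial_ring_def bij_betw_def)

lemma polynomial_ring_base_subset: "polynomial_ring R t R' \<Longrightarrow> R \<subseteq> R'"
  using polynomial_ringD(3)[of R t R' "[:a:]" for a] polys_over_const[OF polynomial_ringD(1)]
  by fastforce

lemma polynomial_ring_var: "polynomial_ring R t R' \<Longrightarrow> t \<in> R'"
  using polynomial_ringD(3)[of R t R' "[:0, 1:]"] polys_over_var[OF polynomial_ringD(1)]
  by fastforce

lemma polynomial_ring_no_zero_divisors:
  assumes P: "polynomial_ring R t R'" and R: "no_zero_divisors_in R"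
  shows "no_zero_divisors_in R'"
  unfolding no_zero_divisors_in_def
proof (intro ballI impI)
  fix a b assume ab: "a \<in> R'" "b \<in> R'" "a * b = 0"
  obtain p where p: "p \<in> polys_over R" "a = poly p t" using polynomial_ringE[OF P ab(1)] .
  obtain q where q: "q \<in> polys_over R" "b = poly q t" using polynomial_ringE[OF P ab(2)] .
  note R' = polynomial_ringD(1)[OF P]
  have "p * q = 0"
    by (rule polynomial_ringD(4)[OF P])
      (use ab p q R' in \<open>simp_all add: polys_over_mult polys_over_0\<close>)
  then have "p = 0 \<or> q = 0"
    using degree_mult_polys_over(1)[OF R p(1) q(1)] by blast
  then show "a = 0 \<or> b = 0"
    using p q by auto
qed

text \<open>
  Degrees add over a ring without zero divisors, so a factor of a nonzero constant is constant.
\<close>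

lemma polynomial_ring_divisor_in_base:
  assumes P: "polynomial_ring R t R'" and R: "no_zero_divisors_in R"
    and gb: "g \<in> R'" "b \<in> R'" "g * b \<in> R" "g * b \<noteq> 0"
  shows "g \<in> R"
proof -
  obtain p where p: "p \<in> polys_over R" "g = poly p t" using polynomial_ringE[OF P gb(1)] .
  obtain q where q: "q \<in> polys_over R" "b = poly q t" using polynomial_ringE[OF P gb(2)] .
  note R' = polynomial_ringD(1)[OF P]
  have "p * q = [:g * b:]"
    by (rule polynomial_ringD(4)[OF P])
      (use gb p q R' in \<open>simp_all add: polys_over_mult polys_over_const\<close>)
  moreover have "p \<noteq> 0" "q \<noteq> 0"
    using gb(4) p q by auto
  ultimately have "Polynomial.degree p = 0"
    using degree_mult_polys_over(2)[OF R p(1) q(1)] by simp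
  then obtain a where "p = [:a:]"
    by (metis degree_eq_zeroE)
  then show ?thesis
    using p by (simp add: polys_over_pCons)
qed

text \<open>
  The universal property of the polynomial ring \<open>R' = R[t]\<close>: apply \<open>h\<close> to the coefficients of the
  unique polynomial that represents an element and substitute \<open>s\<close> for the variable.
\<close>

lemma polynomial_ring_extend_hom:
  fixes h :: "'a::comm_ring_1 \<Rightarrow> 'b::comm_ring_1"
  assumes P: "polynomial_ring R t R'" and h: "unital_hom_on R h"
  obtains h' where "unital_hom_on R' h'" "\<And>x. x \<in> R \<Longrightarrow> h' x = h x" "h' t = s"
proof -
  note R = polynomial_ringD(1)[OF P]
  note h0 = unital_hom_on_0[OF R h]
  define e where "e p = poly (map_poly h p) s" for p
  define h' where "h' x = e (THE p. p \<in> polys_over R \<and> poly p t = x)" for x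
  have h'_poly: "h' (poly p t) = e p" if "p \<in> polys_over R" for p
    unfolding h'_def using that polynomial_ringD(4)[OF P]
    by (intro arg_cong[of _ _ e] the_equality) blast+
  have add: "e (p + q) = e p + e q" if "p \<in> polys_over R" "q \<in> polys_over R" for p q
  proof -
    have "map_poly h (p + q) = map_poly h p + map_poly h q"
      using that by (intro poly_eqI)
        (simp add: coeff_map_poly h0 unital_hom_onD(2)[OF h] polys_over_def)
    then show ?thesis by (simp add: e_def)
  qed
  have mult: "e (p * q) = e p * e q" if "p \<in> polys_over R" "q \<in> polys_over R" for p q
  proof -
    have "map_poly h (p * q) = map_poly h p * map_poly h q"
      using that by (intro poly_eqI)
        (simp add: coeff_map_poly h0 coeff_mult unital_hom_on_sum[OF R h]
          unital_hom_onD(3)[OF h] polys_over_def unital_subringD(6)[OF R])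
    then show ?thesis by (simp add: e_def)
  qed
  show ?thesis
  proof
    show const: "h' x = h x" if "x \<in> R" for x
      using h'_poly[OF polys_over_const[OF R that]] by (simp add: e_def map_poly_pCons h0)
    show "h' t = s"
      using h'_poly[OF polys_over_var[OF R]]
      by (simp add: e_def map_poly_pCons h0 unital_hom_onD(1)[OF h])
    show "unital_hom_on R' h'"
      unfolding unital_hom_on_def
    proof (intro conjI ballI)
      show "h' 1 = 1"
        using const[OF unital_subringD(1)[OF R]] unital_hom_onD(1)[OF h] by simp
      fix a b assume ab: "a \<in> R'" "b \<in> R'"
      obtain p where p: "p \<in> polys_over R" "a = poly p t" using polynomial_ringE[OF P ab(1)] .
      obtain q where q: "q \<in> polys_over R" "b = poly q t" using polynomial_ringE[OF P ab(2)] .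
      show "h' (a + b) = h' a + h' b"
        using h'_poly[OF polys_over_add[OF R p(1) q(1)]]
        by (simp add: p q add h'_poly)
      show "h' (a * b) = h' a * h' b"
        using h'_poly[OF polys_over_mult[OF R p(1) q(1)]]
        by (simp add: p q mult h'_poly)
    qed
  qed
qed


section \<open>The Hilbert basis theorem\<close>

text \<open>
  The coefficients of \<open>t\<^sup>d\<close> in the elements of \<open>J\<close> of degree at most \<open>d\<close>. Zero coefficients are included,
  which makes this set an ideal of \<open>R\<close>.
\<close>

definition leading_coeffs :: "'a::comm_ring_1 set \<Rightarrow> 'a \<Rightarrow> 'a set \<Rightarrow> nat \<Rightarrow> 'a set" where
  "leading_coeffs R t J d =
     {Polynomial.coeff p d | p. p \<in> polys_over R \<and> Polynomial.degree p \<le> d \<and> poly p t \<in> J}"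

lemma ideal_within_diff:
  assumes "unital_subring R" "ideal_within R I" "a \<in> I" "b \<in> I"
  shows "a - b \<in> I"
proof -
  have "- 1 \<in> R"
    by (intro unital_subringD[OF assms(1)])
  then have "(- 1) * b \<in> I"
    using assms(2,4) unfolding ideal_within_def by blast
  then have "a + (-1) * b \<in> I"
    using assms(2,3) unfolding ideal_within_def by blast
  then show ?thesis by simp
qed

lemma leading_coeffs_ideal:
  assumes P: "polynomial_ring R t R'" and J: "ideal_within R' J"
  shows "ideal_within R (leading_coeffs R t J d)"
proof -
  note R = polynomial_ringD(1)[OF P]
  show ?thesis
    unfolding ideal_within_def
  proof (intro conjI ballI)
    show "leading_coeffs R t J d \<subseteq> R"
      by (auto simp: leading_coeffs_def polys_over_def)
    show "0 \<in> leading_coeffs R t J d"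
      using J polys_over_0[OF R] unfolding leading_coeffs_def ideal_within_def
      by (intro CollectI exI[of _ 0]) auto
  next
    fix a b assume "a \<in> leading_coeffs R t J d" "b \<in> leading_coeffs R t J d"
    then obtain p q where
      "p \<in> polys_over R" "Polynomial.degree p \<le> d" "poly p t \<in> J" "a = Polynomial.coeff p d"
      "q \<in> polys_over R" "Polynomial.degree q \<le> d" "poly q t \<in> J" "b = Polynomial.coeff q d"
      by (auto simp: leading_coeffs_def)
    then show "a + b \<in> leading_coeffs R t J d"
      using J polys_over_add[OF R] unfolding leading_coeffs_def ideal_within_def
      by (intro CollectI exI[of _ "p + q"]) (auto intro: degree_add_le)
  next
    fix r a assume r: "r \<in> R" and "a \<in> leading_coeffs R t J d"
    then obtain p where
      "p \<in> polys_over R" "Polynomial.degree p \<le> d" "poly p t \<in> J" "a = Polynomial.coeff p d"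
      by (auto simp: leading_coeffs_def)
    moreover have "smult r p \<in> polys_over R" if "p \<in> polys_over R"
      using that r by (auto simp: polys_over_def intro: unital_subringD[OF R])
    moreover have "r \<in> R'"
      using polynomial_ring_base_subset[OF P] r by blast
    ultimately show "r * a \<in> leading_coeffs R t J d"
      using J unfolding leading_coeffs_def ideal_within_def
      by (intro CollectI exI[of _ "smult r p"]) (auto intro: order.trans[OF degree_smult_le])
  qed
qed

lemma leading_coeffs_mono_ideal:
  "J \<subseteq> J' \<Longrightarrow> leading_coeffs R t J d \<subseteq> leading_coeffs R t J' d"
  by (auto simp: leading_coeffs_def)

lemma leading_coeffs_mono_degree:
  assumes P: "polynomial_ring R t R'" and J: "ideal_within R' J" and "d \<le> d'"
  shows "leading_coeffs R t J d \<subseteq> leading_coeffs R t J d'"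
  using \<open>d \<le> d'\<close>
proof (induction d' rule: dec_induct)
  case (step k)
  have "leading_coeffs R t J k \<subseteq> leading_coeffs R t J (Suc k)"
  proof
    fix a assume "a \<in> leading_coeffs R t J k"
    then obtain p where p: "p \<in> polys_over R" "Polynomial.degree p \<le> k" "poly p t \<in> J"
      "a = Polynomial.coeff p k"
      by (auto simp: leading_coeffs_def)
    \<comment> \<open>Multiplication by the variable shifts the coefficients up by one degree.\<close>
    have "t * poly p t \<in> J"
      using J p(3) polynomial_ring_var[OF P] by (auto simp: ideal_within_def)
    then show "a \<in> leading_coeffs R t J (Suc k)"
      using p unital_subringD(2)[OF polynomial_ringD(1)[OF P]]
      unfolding leading_coeffs_def
      by (intro CollectI exI[of _ "pCons 0 p"])
        (auto simp: polys_over_pCons intro: order.trans[OF degree_pCons_le])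
  qed
  with step show ?case by blast
qed simp

text \<open>
  Nested ideals with the same leading coefficients in every degree are equal: subtracting from an
  element of the larger ideal an element of the smaller one with the same leading coefficient lowers
  the degree.
\<close>

lemma ideals_eq_if_leading_coeffs_eq:
  assumes P: "polynomial_ring R t R'"
    and I: "ideal_within R' I" and J: "ideal_within R' J" and sub: "I \<subseteq> J"
    and eq: "\<And>d. leading_coeffs R t J d = leading_coeffs R t I d"
  shows "I = J"
proof -
  note R = polynomial_ringD(1)[OF P] and R' = polynomial_ringD(2)[OF P]
  have key: "poly p t \<in> I" if "p \<in> polys_over R" "poly p t \<in> J" "Polynomial.degree p < d" for p d
    using that
  proof (induction d arbitrary: p)
    case (Suc d)
    have "Polynomial.coeff p d \<in> leading_coeffs R t J d"
      unfolding leading_coeffs_def using Suc.prems by auto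
    then have "Polynomial.coeff p d \<in> leading_coeffs R t I d"
      unfolding eq .
    then obtain q where q: "q \<in> polys_over R" "Polynomial.degree q \<le> d" "poly q t \<in> I"
      "Polynomial.coeff p d = Polynomial.coeff q d"
      by (auto simp: leading_coeffs_def)
    have "poly (p - q) t \<in> J"
      using ideal_within_diff[OF R' J Suc.prems(2)] q(3) sub by auto
    have "poly (p - q) t \<in> I"
    proof (cases "p - q = 0")
      case True
      then show ?thesis using I by (simp add: ideal_within_def)
    next
      case False
      have "Polynomial.degree (p - q) \<le> d"
        using Suc.prems(3) q(2) by (intro degree_diff_le) auto
      moreover have "Polynomial.degree (p - q) \<noteq> d"
        using False q(4) by (metis coeff_diff diff_self leading_coeff_0_iff)
      ultimately show ?thesis
        using Suc.IH[OF polys_over_diff[OF R Suc.prems(1) q(1)] \<open>poly (p - q) t \<in> J\<close>] by simp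
    qed
    then have "poly (p - q) t + poly q t \<in> I"
      using I q(3) unfolding ideal_within_def by blast
    then show ?case by simp
  qed simp
  have "x \<in> I" if "x \<in> J" for x
  proof -
    have "x \<in> R'" using that J by (auto simp: ideal_within_def)
    then obtain p where "p \<in> polys_over R" "x = poly p t" by (rule polynomial_ringE[OF P])
    then show ?thesis using key that by blast
  qed
  with sub show ?thesis by blast
qed

text \<open>
  Given an increasing chain \<open>J\<close> of ideals of \<open>R[t]\<close>, the ideals \<open>L k d\<close> of leading coefficients of
  \<open>J k\<close> in degree \<open>d\<close> increase in both indices. The diagonal \<open>L m m\<close> is stationary from some \<open>m\<close> on,
  which settles all degrees \<open>d \<ge> m\<close> at once; each of the finitely many smaller degrees is stationary
  from some point on as well. Beyond the largest of these bounds all leading coefficients agree, hence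
  so do the ideals. Arguing with chains avoids any choice of generators.
\<close>

theorem hilbert_basis:
  assumes P: "polynomial_ring R t R'" and acc: "acc_on_ideals R"
  shows "acc_on_ideals R'"
  unfolding acc_on_ideals_def
proof (intro allI impI, elim conjE)
  fix J :: "nat \<Rightarrow> 'a set"
  assume "\<forall>n. ideal_within R' (J n)" and inc: "incseq J"
  then have J: "ideal_within R' (J n)" for n by blast
  define L where "L k d = leading_coeffs R t (J k) d" for k d
  have L: "ideal_within R (L k d)" for k d
    unfolding L_def by (rule leading_coeffs_ideal[OF P J])
  have mono: "L k d \<subseteq> L k' d'" if "k \<le> k'" "d \<le> d'" for k k' d d'
    unfolding L_def
    using leading_coeffs_mono_degree[OF P J that(2)]
      leading_coeffs_mono_ideal[OF incseqD[OF inc that(1)]] by blast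
  have "incseq (\<lambda>m. L m m)"
    by (intro incseq_SucI mono) auto
  then obtain m where m: "\<And>n. n \<ge> m \<Longrightarrow> L n n = L m m"
    using acc L unfolding acc_on_ideals_def by meson
  have "incseq (\<lambda>k. L k d)" for d
    by (intro incseq_SucI mono) auto
  then have "\<exists>N. \<forall>n\<ge>N. L n d = L N d" for d
    using acc L unfolding acc_on_ideals_def by meson
  then obtain K where K: "\<And>d n. n \<ge> K d \<Longrightarrow> L n d = L (K d) d"
    by metis
  define N where "N = Max (insert m (K ` {..<m}))"
  have N: "N \<ge> m" "\<And>d. d < m \<Longrightarrow> N \<ge> K d"
    by (simp_all add: N_def)
  have "L n d = L N d" if "n \<ge> N" for n d
  proof (cases "d < m")
    case True
    then show ?thesis
      using K[of d n] K[of d N] N(2)[of d] that by simp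
  next
    case False
    \<comment> \<open>Squeeze \<open>L k d\<close> between two members of the stationary part of the diagonal.\<close>
    have *: "L k d = L m m" if "k \<ge> m" for k
    proof
      show "L m m \<subseteq> L k d" using that False by (intro mono) auto
      have "L k d \<subseteq> L (max k d) (max k d)" by (intro mono) auto
      also have "\<dots> = L m m" using that by (intro m) auto
      finally show "L k d \<subseteq> L m m" .
    qed
    show ?thesis using *[of n] *[of N] N(1) that by simp
  qed
  then have "J n = J N" if "n \<ge> N" for n
    using ideals_eq_if_leading_coeffs_eq[OF P J J incseqD[OF inc that]] that
    unfolding L_def by metis
  then show "\<exists>N. \<forall>n\<ge>N. J n = J N" by blast
qed

text \<open>
  Finite generation of ideals gives the chain condition: the union of a chain of ideals is one of its
  members.
\<close>

lemma acc_on_ideals_noetherian_ring: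
  assumes "noetherian_ring (ring_of_type_algebra :: 'a::comm_ring_1 ring)"
  shows "acc_on_ideals (UNIV :: 'a set)"
  unfolding acc_on_ideals_def
proof (intro allI impI, elim conjE)
  fix I :: "nat \<Rightarrow> 'a set"
  assume "\<forall>n. ideal_within UNIV (I n)" and inc: "incseq I"
  then have I: "ideal_within UNIV (I n)" for n by blast
  have absorb: "x * a \<in> I n" "a * x \<in> I n" if "a \<in> I n" for a x n
    using I[of n] that by (simp_all add: ideal_within_def mult.commute[of a])
  have "ideal (I n) (ring_of_type_algebra :: 'a ring)" for n
  proof (rule idealI)
    show "ring (ring_of_type_algebra :: 'a ring)" by (rule ring_from_type_algebra)
    have inv: "inv\<^bsub>add_monoid (ring_of_type_algebra :: 'a ring)\<^esub> a = - a" for a :: 'a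
    proof -
      interpret ring "ring_of_type_algebra :: 'a ring" by (rule ring_from_type_algebra)
      have "\<ominus>\<^bsub>ring_of_type_algebra :: 'a ring\<^esub> a = - a"
        by (rule minus_equality) (simp_all add: ring_of_type_algebra_def)
      then show ?thesis by (simp add: a_inv_def)
    qed
    have "- a \<in> I n" if "a \<in> I n" for a
      using ideal_within_diff[OF _ I _ that, of 0] I[of n]
      by (simp add: ideal_within_def unital_subring_def)
    then show "subgroup (I n) (add_monoid (ring_of_type_algebra :: 'a ring))"
      using I[of n] inv
      by (intro subgroup.intro) (auto simp: ideal_within_def ring_of_type_algebra_def)
  qed (simp_all add: ring_of_type_algebra_def absorb)
  moreover have "I m \<subseteq> I n \<or> I n \<subseteq> I m" for m n
    using incseqD[OF inc] nle_le by metis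
  ultimately have "subset.chain {J. ideal J (ring_of_type_algebra :: 'a ring)} (range I)"
    unfolding subset_chain_def by blast
  then have "\<Union>(range I) \<in> range I"
    by (intro noetherian_ring.ideal_chain_is_trivial[OF assms]) auto
  then obtain N where "\<Union>(range I) = I N" by blast
  then have "I n = I N" if "n \<ge> N" for n
    using incseqD[OF inc that] by blast
  then show "\<exists>N. \<forall>n\<ge>N. I n = I N" by blast
qed

lemma acc_on_ideals_image:
  assumes acc: "acc_on_ideals R" and h: "unital_hom_on R h" and R: "unital_subring R"
  shows "acc_on_ideals (h ` R)"
  unfolding acc_on_ideals_def
proof (intro allI impI, elim conjE)
  fix I :: "nat \<Rightarrow> 'b set"
  assume "\<forall>n. ideal_within (h ` R) (I n)" and inc: "incseq I"
  then have I: "ideal_within (h ` R) (I n)" for n by blast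
  define J where "J n = {x \<in> R. h x \<in> I n}" for n
  have "ideal_within R (J n)" for n
    using I[of n] unfolding ideal_within_def J_def
    by (auto simp: unital_hom_onD[OF h] unital_hom_on_0[OF R h] intro: unital_subringD[OF R])
  moreover have "incseq J"
    using inc by (auto simp: J_def incseq_def)
  ultimately obtain N where "\<And>n. n \<ge> N \<Longrightarrow> J n = J N"
    using acc unfolding acc_on_ideals_def by blast
  moreover have "I n = h ` J n" for n
    using I[of n] by (auto simp: ideal_within_def J_def)
  ultimately show "\<exists>N. \<forall>n\<ge>N. I n = I N" by metis
qed

text \<open>
  The kernels of the iterates \<open>f ^^ n\<close> increase, so \<open>ker (f ^^ N) = ker (f ^^ Suc N)\<close> for some \<open>N\<close>. If
  \<open>f x = 0\<close>, write \<open>x = (f ^^ N) y\<close>; then \<open>y\<close> lies in the second kernel, hence in the first, and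
  \<open>x = 0\<close>.
\<close>

lemma surjective_endomorphism_inj:
  fixes f :: "'a::comm_ring_1 \<Rightarrow> 'a"
  assumes acc: "acc_on_ideals (UNIV :: 'a set)" and f: "unital_hom_on UNIV f" and "surj f"
  shows "inj f"
proof -
  note f0 = unital_hom_on_0[OF unital_subring_UNIV f]
  have add: "(f ^^ n) (a + b) = (f ^^ n) a + (f ^^ n) b" for n a b
    by (induction n) (simp_all add: unital_hom_onD(2)[OF f])
  have mult: "(f ^^ n) (a * b) = (f ^^ n) a * (f ^^ n) b" for n a b
    by (induction n) (simp_all add: unital_hom_onD(3)[OF f])
  have zero: "(f ^^ n) 0 = 0" for n
    by (induction n) (simp_all add: f0)
  define I where "I n = {x. (f ^^ n) x = 0}" for n
  have "ideal_within UNIV (I n)" for n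
    by (auto simp: ideal_within_def I_def add mult zero)
  moreover have "incseq I"
    by (rule incseq_SucI) (auto simp: I_def f0)
  ultimately obtain N where N: "\<And>n. n \<ge> N \<Longrightarrow> I n = I N"
    using acc unfolding acc_on_ideals_def by blast
  have ker: "x = 0" if "f x = 0" for x
  proof -
    obtain y where y: "x = (f ^^ N) y"
      using surj_fn[OF \<open>surj f\<close>, of N] by (metis surjE)
    have "y \<in> I (Suc N)" using that y by (simp add: I_def)
    then have "y \<in> I N" using N[of "Suc N"] by simp
    then show ?thesis using y by (simp add: I_def)
  qed
  show ?thesis
  proof (rule injI)
    fix x y assume "f x = f y"
    then have "f (x + - y) = 0"
      by (simp add: unital_hom_onD(2)[OF f] unital_hom_on_minus[OF unital_subring_UNIV f]
          del: add_uminus_conv_diff)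
    then show "x = y" using ker by fastforce
  qed
qed


section \<open>Towers of polynomial rings\<close>

definition polynomial_tower :: "nat \<Rightarrow> (nat \<Rightarrow> 'a::comm_ring_1 set) \<Rightarrow> (nat \<Rightarrow> 'a) \<Rightarrow> bool" where
  "polynomial_tower n C t \<longleftrightarrow> (\<forall>i<n. polynomial_ring (C i) (t i) (C (Suc i)))"

lemma polynomial_tower_Suc:
  "polynomial_tower (Suc n) C t \<longleftrightarrow>
     polynomial_tower n C t \<and> polynomial_ring (C n) (t n) (C (Suc n))"
  by (auto simp: polynomial_tower_def less_Suc_eq)

lemma polynomial_tower_base_subset: "polynomial_tower n C t \<Longrightarrow> C 0 \<subseteq> C n"
proof (induction n)
  case (Suc n)
  then show ?case
    using polynomial_ring_base_subset[of "C n" "t n" "C (Suc n)"]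
    by (auto simp: polynomial_tower_Suc)
qed simp

lemma polynomial_tower_subset:
  assumes "polynomial_tower n C t" "unital_subring S" "C 0 \<subseteq> S" "\<And>i. i < n \<Longrightarrow> t i \<in> S"
  shows "C n \<subseteq> S"
  using assms(1,4)
proof (induction n)
  case (Suc n)
  then have P: "polynomial_ring (C n) (t n) (C (Suc n))" and "C n \<subseteq> S"
    by (simp_all add: polynomial_tower_Suc)
  with Suc.prems(2)[of n] show ?case
    by (auto elim!: polynomial_ringE[OF P] intro: poly_in_subring[OF assms(2)])
qed (use assms(3) in simp)

lemma polynomial_tower_extend_hom:
  assumes "polynomial_tower n C t" "unital_hom_on (C 0) h"
  obtains h' where "unital_hom_on (C n) h'" "\<And>x. x \<in> C 0 \<Longrightarrow> h' x = h x"
    "\<And>i. i < n \<Longrightarrow> h' (t i) = s i"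
  using assms
proof (induction n arbitrary: thesis)
  case 0
  then show ?case by blast
next
  case (Suc n)
  then have T: "polynomial_tower n C t" and P: "polynomial_ring (C n) (t n) (C (Suc n))"
    by (simp_all add: polynomial_tower_Suc)
  obtain g where g: "unital_hom_on (C n) g" "\<And>x. x \<in> C 0 \<Longrightarrow> g x = h x"
    "\<And>i. i < n \<Longrightarrow> g (t i) = s i"
    using Suc.IH[OF _ T Suc.prems(3)] by blast
  obtain h' where h': "unital_hom_on (C (Suc n)) h'" "\<And>x. x \<in> C n \<Longrightarrow> h' x = g x"
    "h' (t n) = s n"
    using polynomial_ring_extend_hom[OF P g(1)] by blast
  have "t i \<in> C n" if "i < n" for i
  proof -
    have "polynomial_tower (n - Suc i) (\<lambda>j. C (Suc i + j)) (\<lambda>j. t (Suc i + j))"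
      using T by (auto simp: polynomial_tower_def)
    from polynomial_tower_base_subset[OF this] have "C (Suc i) \<subseteq> C n"
      using that by simp
    moreover have "polynomial_ring (C i) (t i) (C (Suc i))"
      using T that by (simp add: polynomial_tower_def)
    ultimately show ?thesis using polynomial_ring_var by blast
  qed
  then have "h' (t i) = s i" if "i < Suc n" for i
    using that h'(2,3) g(3) by (cases "i = n") simp_all
  moreover have "h' x = h x" if "x \<in> C 0" for x
    using that h'(2) g(2) polynomial_tower_base_subset[OF T] by auto
  ultimately show ?case
    using Suc.prems(1)[OF h'(1)] by blast
qed

lemma polynomial_tower_acc:
  "polynomial_tower n C t \<Longrightarrow> acc_on_ideals (C 0) \<Longrightarrow> acc_on_ideals (C n)"
proof (induction n)
  case (Suc n)
  then show ?case
    using hilbert_basis[of "C n" "t n" "C (Suc n)"] by (simp add: polynomial_tower_Suc)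
qed simp

lemma polynomial_tower_no_zero_divisors:
  "polynomial_tower n C t \<Longrightarrow> no_zero_divisors_in (C 0) \<Longrightarrow> no_zero_divisors_in (C n)"
proof (induction n)
  case (Suc n)
  then show ?case
    using polynomial_ring_no_zero_divisors[of "C n" "t n" "C (Suc n)"]
    by (simp add: polynomial_tower_Suc)
qed simp

text \<open>
  The induction descends one level at a time. The cofactor \<open>b\<close> has to descend together with \<open>g\<close>, and it
  does by the symmetric argument.
\<close>

lemma polynomial_tower_divisor_in_base:
  assumes "polynomial_tower n C t" "no_zero_divisors_in (C 0)"
    and "g \<in> C n" "b \<in> C n" "g * b \<in> C 0" "g * b \<noteq> 0"
  shows "g \<in> C 0"
  using assms
proof (induction n arbitrary: b)
  case (Suc n)
  from Suc.prems(1)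
  have T: "polynomial_tower n C t" and P: "polynomial_ring (C n) (t n) (C (Suc n))"
    by (simp_all add: polynomial_tower_Suc)
  note D = polynomial_tower_no_zero_divisors[OF T Suc.prems(2)]
  have gb: "g * b \<in> C n"
    using polynomial_tower_base_subset[OF T] Suc.prems(5) by blast
  have "g \<in> C n"
    by (rule polynomial_ring_divisor_in_base[OF P D Suc.prems(3,4) gb Suc.prems(6)])
  moreover have "b \<in> C n"
    by (rule polynomial_ring_divisor_in_base[OF P D Suc.prems(4,3)])
      (use gb Suc.prems(6) in \<open>simp_all add: mult.commute\<close>)
  ultimately show ?case
    using Suc.IH[OF T Suc.prems(2) _ _ Suc.prems(5,6)] by blast
qed simp

text \<open>
  Having as many variables in \<open>D\<close> as in \<open>C\<close> makes the map \<open>g\<close> below surjective, and the chain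
  condition makes \<open>g \<circ> \<phi>\<close> injective. Then the retraction of \<open>C n\<close> onto \<open>C 0\<close> is injective on the
  preimage of \<open>D 0\<close>, and a retraction that is injective on a set containing its image fixes that set.
\<close>

theorem polynomial_tower_base_rigid:
  fixes \<phi> :: "'a::comm_ring_1 \<Rightarrow> 'b::comm_ring_1"
  assumes C: "polynomial_tower n C t" "C n = UNIV" "unital_subring (C 0)" "acc_on_ideals (C 0)"
    and D: "polynomial_tower n D s" "D n = UNIV" "unital_subring (D 0)"
    and \<phi>: "unital_hom_on UNIV \<phi>" "bij \<phi>" and sub: "\<phi> ` C 0 \<subseteq> D 0"
  shows "\<phi> ` C 0 = D 0"
proof -
  have id: "unital_hom_on (C 0) (\<lambda>x. x)" by (simp add: unital_hom_on_def)
  \<comment> \<open>The retraction onto the base that kills all variables.\<close>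
  obtain \<pi> where \<pi>: "unital_hom_on UNIV \<pi>" "\<And>x. x \<in> C 0 \<Longrightarrow> \<pi> x = x"
    "\<And>i. i < n \<Longrightarrow> \<pi> (t i) = 0"
    using polynomial_tower_extend_hom[OF C(1) id, of "\<lambda>_. 0"] unfolding C(2) by blast
  have "C n \<subseteq> {x \<in> UNIV. \<pi> x \<in> C 0}"
    by (rule polynomial_tower_subset[OF C(1)
          unital_subring_vimage[OF unital_subring_UNIV \<pi>(1) C(3)]])
      (use \<pi> unital_subringD(2)[OF C(3)] in auto)
  then have \<pi>_base: "\<pi> x \<in> C 0" for x
    unfolding C(2) by blast
  define \<theta> where "\<theta> = inv_into UNIV \<phi>"
  have \<theta>\<phi>: "\<theta> (\<phi> x) = x" and \<phi>\<theta>: "\<phi> (\<theta> y) = y" for x y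
    using \<phi>(2) by (simp_all add: \<theta>_def bij_is_inj bij_is_surj surj_f_inv_f)
  have \<theta>: "unital_hom_on UNIV \<theta>"
    unfolding unital_hom_on_def
  proof (intro conjI ballI)
    show "\<theta> 1 = 1"
      using \<theta>\<phi>[of 1] by (simp add: unital_hom_onD(1)[OF \<phi>(1)])
    fix a b
    show "\<theta> (a + b) = \<theta> a + \<theta> b"
      using \<theta>\<phi>[of "\<theta> a + \<theta> b"] by (simp add: unital_hom_onD(2)[OF \<phi>(1)] \<phi>\<theta>)
    show "\<theta> (a * b) = \<theta> a * \<theta> b"
      using \<theta>\<phi>[of "\<theta> a * \<theta> b"] by (simp add: unital_hom_onD(3)[OF \<phi>(1)] \<phi>\<theta>)
  qed
  \<comment> \<open>Retract the larger base \<open>D 0\<close> onto \<open>C 0\<close> and rename its variables to those of \<open>C\<close>.\<close>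
  have "unital_hom_on (D 0) (\<lambda>y. \<pi> (\<theta> y))"
    by (simp add: unital_hom_on_def unital_hom_onD[OF \<pi>(1)] unital_hom_onD[OF \<theta>])
  from polynomial_tower_extend_hom[OF D(1) this, of t]
  obtain g where g: "unital_hom_on UNIV g" "\<And>y. y \<in> D 0 \<Longrightarrow> g y = \<pi> (\<theta> y)"
    "\<And>i. i < n \<Longrightarrow> g (s i) = t i"
    unfolding D(2) by blast
  have "C n \<subseteq> range g"
  proof (rule polynomial_tower_subset[OF C(1) unital_subring_image[OF unital_subring_UNIV g(1)]])
    show "C 0 \<subseteq> range g"
    proof
      fix x assume x: "x \<in> C 0"
      then have "g (\<phi> x) = x" using sub g(2) \<pi>(2) \<theta>\<phi> by auto
      then show "x \<in> range g" by (metis rangeI)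
    qed
    show "t i \<in> range g" if "i < n" for i
      using g(3)[OF that] by (metis rangeI)
  qed
  then have "surj g"
    using C(2) by auto
  then have "surj (g \<circ> \<phi>)"
    using bij_is_surj[OF \<phi>(2)] by (intro comp_surj)
  moreover have "unital_hom_on UNIV (g \<circ> \<phi>)"
    by (simp add: unital_hom_on_def unital_hom_onD[OF \<phi>(1)] unital_hom_onD[OF g(1)])
  moreover have "acc_on_ideals (UNIV :: 'a set)"
    using polynomial_tower_acc[OF C(1,4)] C(2) by simp
  ultimately have inj: "inj (g \<circ> \<phi>)"
    using surjective_endomorphism_inj by blast
  have "y \<in> \<phi> ` C 0" if y: "y \<in> D 0" for y
  proof -
    \<comment> \<open>\<open>\<theta> y\<close> and its retraction have the same image under the injective map \<open>g \<circ> \<phi>\<close>.\<close>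
    have "\<phi> (\<pi> (\<theta> y)) \<in> D 0"
      using sub \<pi>_base by blast
    then have "g (\<phi> (\<pi> (\<theta> y))) = g (\<phi> (\<theta> y))"
      using g(2) y \<pi>(2)[OF \<pi>_base] by (simp add: \<theta>\<phi> \<phi>\<theta>)
    then have "\<pi> (\<theta> y) = \<theta> y"
      using injD[OF inj, of "\<pi> (\<theta> y)" "\<theta> y"] by simp
    then show ?thesis
      using \<pi>_base[of "\<theta> y"] \<phi>\<theta>[of y] by (metis imageI)
  qed
  with sub show ?thesis by blast
qed


section \<open>Iterated Poisson-Ore extensions\<close>

lemma poisson_homD:
  assumes "poisson_hom scale br scale' br' \<phi>"
  shows "\<phi> 1 = 1" "\<phi> (a + b) = \<phi> a + \<phi> b" "\<phi> (a * b) = \<phi> a * \<phi> b"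
    "\<phi> (scale c a) = scale' c (\<phi> a)" "\<phi> (br a b) = br' (\<phi> a) (\<phi> b)"
  using assms by (auto simp: poisson_hom_def Vector_Spaces.linear_iff)

lemma poisson_hom_unital_hom_on:
  "poisson_hom scale br scale' br' \<phi> \<Longrightarrow> unital_hom_on R \<phi>"
  by (simp add: unital_hom_on_def poisson_homD)

text \<open>
  Additive inverses come from scalar multiplication by \<open>-1\<close>.
\<close>

lemma poisson_subalgebra_unital_subring:
  assumes "poisson_algebra scale br" "poisson_subalgebra scale br R"
  shows "unital_subring R"
proof -
  interpret poisson_algebra scale br by fact
  have "- a \<in> R" if "a \<in> R" for a
  proof -
    have "scale (- 1) a \<in> R"
      using assms(2) that unfolding poisson_subalgebra_def by blast
    then show ?thesis by (simp add: scale_minus_left)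
  qed
  with assms(2) show ?thesis
    by (simp add: poisson_subalgebra_def unital_subring_def)
qed

lemma iterated_poisson_ore_extension_tower:
  assumes "iterated_poisson_ore_extension n scale br \<iota> sB brB"
  obtains C t where "polynomial_tower n C t" "C 0 = range \<iota>" "C n = UNIV"
proof -
  obtain C t \<alpha> \<delta> where "C 0 = range \<iota>" "C n = UNIV"
    and "\<And>i. i < n \<Longrightarrow> poisson_ore_extension sB brB (C i) (t i) (\<alpha> i) (\<delta> i) (C (Suc i))"
    using assms unfolding iterated_poisson_ore_extension_def by blast
  moreover from assms have "poisson_algebra sB brB"
    by (simp add: iterated_poisson_ore_extension_def)
  ultimately show ?thesis
    by (intro that[of C t])
      (auto simp: polynomial_tower_def polynomial_ring_def poisson_ore_extension_def
        intro: poisson_subalgebra_unital_subring)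
qed

lemma poisson_subalgebra_range:
  assumes "poisson_algebra scale br" "poisson_hom scale br scale' br' \<iota>"
  shows "poisson_subalgebra scale' br' (range \<iota>)"
proof -
  note h = poisson_homD[OF assms(2)]
  have "\<iota> 0 = 0" using h(2)[of 0 0] by simp
  then show ?thesis
    unfolding poisson_subalgebra_def
    by (auto simp flip: h)
qed

lemma poisson_subalgebra_vimage:
  assumes "poisson_hom scale br scale' br' \<phi>" "poisson_subalgebra scale' br' S"
  shows "poisson_subalgebra scale br (\<phi> -` S)"
proof -
  note h = poisson_homD[OF assms(1)]
  have "\<phi> 0 = 0" using h(2)[of 0 0] by simp
  with assms(2) show ?thesis
    unfolding poisson_subalgebra_def by (simp add: h)
qed

text \<open>
  The divisor subalgebra of \<open>F\<close> lies in every Poisson subalgebra that contains \<open>F\<close> and all divisors of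
  its own nonzero elements, because each stage of the construction does.
\<close>

lemma divisor_subalgebra_minimal:
  assumes S: "poisson_subalgebra scale br S"
    and div: "\<And>g b. g * b \<in> S \<Longrightarrow> g * b \<noteq> 0 \<Longrightarrow> g \<in> S" and "F \<subseteq> S"
  shows "divisor_subalgebra scale br F \<subseteq> S"
proof -
  have "divisor_stage scale br F n \<subseteq> S" for n
  proof (induction n)
    case (Suc n)
    then have "Sw (divisor_stage scale br F n) \<subseteq> S"
      using div by (auto simp: Sw_def)
    then show ?case
      using hull_minimal[of _ S "poisson_subalgebra scale br"] S by simp
  qed (use \<open>F \<subseteq> S\<close> in simp)
  then show ?thesis
    by (auto simp: divisor_subalgebra_def)
qed

lemma poisson_iso_comp_inv:
  fixes f :: "'a::comm_ring_1 \<Rightarrow> 'c::comm_ring_1" and g :: "'b::comm_ring_1 \<Rightarrow> 'c"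
  assumes f: "poisson_hom scale br sB brB f" "inj f"
    and g: "poisson_hom scale' br' sB brB g" "inj g" and eq: "range f = range g"
  shows "poisson_iso scale br scale' br' (inv_into UNIV g \<circ> f)"
proof -
  define \<psi> where "\<psi> = inv_into UNIV g \<circ> f"
  have \<psi>: "g (\<psi> x) = f x" for x
    unfolding \<psi>_def comp_def by (rule f_inv_into_f) (simp flip: eq)
  have \<psi>_eqI: "\<psi> x = y" if "f x = g y" for x y
    using that \<psi>[of x] g(2) by (metis injD)
  note F = poisson_homD[OF f(1)] and G = poisson_homD[OF g(1)]
  have hom: "\<psi> 1 = 1" "\<psi> (a + b) = \<psi> a + \<psi> b" "\<psi> (a * b) = \<psi> a * \<psi> b"
    "\<psi> (scale c a) = scale' c (\<psi> a)" "\<psi> (br a b) = br' (\<psi> a) (\<psi> b)" for a b c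
    by (rule \<psi>_eqI, simp add: F G \<psi>)+
  have "Vector_Spaces.linear scale scale' \<psi>"
    using f(1) g(1) hom by (simp add: poisson_hom_def Vector_Spaces.linear_iff)
  moreover have "bij \<psi>"
  proof (rule bijI)
    show "inj \<psi>"
      using \<psi> f(2) by (metis injD injI)
    show "surj \<psi>"
      unfolding surj_def
    proof
      fix y
      obtain x where "f x = g y" using eq by (metis rangeE rangeI)
      then show "\<exists>x. y = \<psi> x" using \<psi>_eqI by metis
    qed
  qed
  ultimately show ?thesis
    unfolding poisson_iso_def poisson_hom_def \<psi>_def[symmetric] using hom by blast
qed

theorem theorem4p15:
  fixes scale :: "'k::field_char_0 \<Rightarrow> 'a::idom \<Rightarrow> 'a"
    and br :: "'a \<Rightarrow> 'a \<Rightarrow> 'a"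
  assumes "noetherian_poisson_stratiform_domain scale br"
    and "divisor_subalgebra scale br {1} = UNIV"
  shows "strongly_poisson_skew_cancellative TYPE('b::idom) TYPE('c::comm_ring_1)
           TYPE('d::comm_ring_1) scale br"
  unfolding strongly_poisson_skew_cancellative_def
proof (intro allI impI, elim exE)
  fix n :: nat and scale' :: "'k \<Rightarrow> 'b \<Rightarrow> 'b" and br'
    and sB :: "'k \<Rightarrow> 'c \<Rightarrow> 'c" and brB \<iota> and sB' :: "'k \<Rightarrow> 'd \<Rightarrow> 'd" and brB' \<iota>' \<phi>
  assume A': "noetherian_poisson_stratiform_domain scale' br'"
    and B: "iterated_poisson_ore_extension n scale br \<iota> sB brB"
    and B': "iterated_poisson_ore_extension n scale' br' \<iota>' sB' brB'"
    and iso: "poisson_iso sB brB sB' brB' \<phi>"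
  have \<iota>: "poisson_hom scale br sB brB \<iota>" "inj \<iota>"
    and \<iota>': "poisson_hom scale' br' sB' brB' \<iota>'" "inj \<iota>'"
    using B B' by (simp_all add: iterated_poisson_ore_extension_def)
  have \<phi>: "poisson_hom sB brB sB' brB' \<phi>" "bij \<phi>"
    using iso by (simp_all add: poisson_iso_def)
  obtain C t where C: "polynomial_tower n C t" "C 0 = range \<iota>" "C n = UNIV"
    using iterated_poisson_ore_extension_tower[OF B] .
  obtain D s where D: "polynomial_tower n D s" "D 0 = range \<iota>'" "D n = UNIV"
    using iterated_poisson_ore_extension_tower[OF B'] .
  have comp: "poisson_hom scale br sB' brB' (\<phi> \<circ> \<iota>)"
    using \<iota>(1) \<phi>(1) by (simp add: poisson_hom_def Vector_Spaces.linear_iff)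
  have \<iota>'_eq_0: "\<iota>' x = 0 \<longleftrightarrow> x = 0" for x
    using \<iota>'(2) unital_hom_on_0[OF unital_subring_UNIV poisson_hom_unital_hom_on[OF \<iota>'(1)]]
    by (metis injD)
  have D_domain: "no_zero_divisors_in (D 0)"
    unfolding D(2) no_zero_divisors_in_def
    by (auto simp: \<iota>'_eq_0 simp flip: poisson_homD(3)[OF \<iota>'(1)])
  have inj: "inj (\<phi> \<circ> \<iota>)"
    using \<iota>(2) bij_is_inj[OF \<phi>(2)] by (intro inj_compose)
  have "divisor_subalgebra scale br {1} \<subseteq> (\<phi> \<circ> \<iota>) -` D 0"
  proof (rule divisor_subalgebra_minimal)
    show "poisson_subalgebra scale br ((\<phi> \<circ> \<iota>) -` D 0)"
      unfolding D(2) using A'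
      by (intro poisson_subalgebra_vimage[OF comp] poisson_subalgebra_range[OF _ \<iota>'(1)])
        (simp add: noetherian_poisson_stratiform_domain_def poisson_stratiform_domain_def)
    show "{1} \<subseteq> (\<phi> \<circ> \<iota>) -` D 0"
      unfolding D(2) using poisson_homD(1)[OF comp] poisson_homD(1)[OF \<iota>'(1)]
      by auto
    fix g b assume gb: "g * b \<in> (\<phi> \<circ> \<iota>) -` D 0" "g * b \<noteq> 0"
    have "(\<phi> \<circ> \<iota>) (g * b) \<noteq> 0"
      using gb(2) inj unital_hom_on_0[OF unital_subring_UNIV poisson_hom_unital_hom_on[OF comp]]
      by (metis injD)
    with gb(1) show "g \<in> (\<phi> \<circ> \<iota>) -` D 0"
      using polynomial_tower_divisor_in_base[OF D(1) D_domain, of "(\<phi> \<circ> \<iota>) g" "(\<phi> \<circ> \<iota>) b"]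
      unfolding vimage_eq poisson_homD(3)[OF comp] D(3) by blast
  qed
  then have sub: "\<phi> ` C 0 \<subseteq> D 0"
    unfolding assms(2) C(2) by auto
  have acc: "acc_on_ideals (UNIV :: 'a set)"
    using assms(1)
    by (intro acc_on_ideals_noetherian_ring) (simp add: noetherian_poisson_stratiform_domain_def)
  have "\<phi> ` C 0 = D 0"
  proof (rule polynomial_tower_base_rigid[OF C(1,3) _ _ D(1,3) _ _ \<phi>(2) sub])
    show "unital_subring (C 0)"
      unfolding C(2)
      by (rule unital_subring_image[OF unital_subring_UNIV poisson_hom_unital_hom_on[OF \<iota>(1)]])
    show "unital_subring (D 0)"
      unfolding D(2)
      by (rule unital_subring_image[OF unital_subring_UNIV poisson_hom_unital_hom_on[OF \<iota>'(1)]])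
    show "acc_on_ideals (C 0)"
      unfolding C(2) by (rule acc_on_ideals_image[OF acc poisson_hom_unital_hom_on[OF \<iota>(1)]
          unital_subring_UNIV])
    show "unital_hom_on UNIV \<phi>"
      by (rule poisson_hom_unital_hom_on[OF \<phi>(1)])
  qed
  then have "range (\<phi> \<circ> \<iota>) = range \<iota>'"
    by (simp add: C(2) D(2) image_comp)
  then show "\<exists>\<psi>. poisson_iso scale br scale' br' \<psi>"
    using poisson_iso_comp_inv[OF comp inj \<iota>'] by blast
qed

end
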